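(* Let $n\ge 1$, $0\le k\le n-1$ be integers and let $a\in(0;1)$. Let $g_{n,k}\in\mathcal H$ be the unique function such that $f^{(k)}(a)=(f,g_{n,k})_{\mathcal H}$ for all $f\in\mathcal H$. Then $$ g_{n,k}(x)=\begin{cases} \dfrac{(-1)^{n-k-1}}{(2n-k-1)!}(1-a)^{n-k}x^n\, h_{n,k}(1-x,1-a), & x\in[0;a],\\[2mm] \dfrac{(-1)^{n-1}}{(2n-k-1)!}a^{n-k}(1-x)^{n}\, h_{n,k}(x,a), & x\in[a;1], \end{cases} $$ where $$ h_{n,k}(x,a)=\sum_{l=0}^{n-1}(-1)^{n-1-l}\binom{2n-1-k}{n-1-l}x^{n-1-l}a^l\sum_{m=0}^{l}\binom{n-1+m}{m}x^{m}. $$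
   Context: $\mathcal H=\mathring{W}_2^n[0;1]$ is the Sobolev space of functions $f$ on $[0;1]$ whose derivatives up to order $n-1$ are absolutely continuous, with $f^{(n)}\in L_2[0;1]$ and $f^{(j)}(0)=f^{(j)}(1)=0$ for $j=0,1,\dots,n-1$. It is a Hilbert space with inner product $(f,g)_{\mathcal H}=\int_0^1 f^{(n)}(x)\overline{g^{(n)}(x)}\,dx$. The functional $f\mapsto f^{(k)}(a)$ is continuous on $\mathcal H$, so $g_{n,k}$ exists and is unique by the Riesz theorem. *)

theory Defs
  imports "HOL-Analysis.Analysis"
begin

definition absolutely_continuous_on :: "real set \<Rightarrow> (real \<Rightarrow> complex) \<Rightarrow> bool" where
  "absolutely_continuous_on S f \<longleftrightarrow>
     (\<forall>e>0. \<exists>d>0. \<forall>D T. D division_of T \<and> T \<subseteq> S \<and> (\<Sum>K\<in>D. Sup K - Inf K) < d \<longrightarrow>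
        (\<Sum>K\<in>D. norm (f (Sup K) - f (Inf K))) < e)"

definition in_L2 :: "real set \<Rightarrow> (real \<Rightarrow> complex) \<Rightarrow> bool" where
  "in_L2 S f \<longleftrightarrow> f \<in> borel_measurable (lebesgue_on S) \<and>
     integrable (lebesgue_on S) (\<lambda>x. (norm (f x))\<^sup>2)"

(* Derivatives relative to [0,1], i.e. one-sided at 0 and 1. The value at a point where the
   derivative does not exist is arbitrary, so existence is required separately below. *)
primrec nth_deriv :: "nat \<Rightarrow> (real \<Rightarrow> complex) \<Rightarrow> real \<Rightarrow> complex" where
  "nth_deriv 0 f = f"
| "nth_deriv (Suc j) f = (\<lambda>x. vector_derivative (nth_deriv j f) (at x within {0..1}))"

(* A function on [0,1] is represented by the function on the reals that is undefined elsewhere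
   (extensional), so that equality in the space is equality on [0,1].
   The condition on the derivative of order n - 1 says that the n-th derivative exists almost
   everywhere; it is implied by absolute continuity (Lebesgue) and listed as part of what it
   means for the n-th derivative to be an element of L2. *)
definition sobolev0 :: "nat \<Rightarrow> (real \<Rightarrow> complex) set" where
  "sobolev0 n = {f. f \<in> extensional {0..1} \<and>
     (\<forall>j. Suc j < n \<longrightarrow> (\<forall>x\<in>{0..1}. nth_deriv j f differentiable (at x within {0..1}))) \<and>
     (\<forall>j<n. absolutely_continuous_on {0..1} (nth_deriv j f)) \<and>
     (AE x in lebesgue_on {0..1}. nth_deriv (n - 1) f differentiable (at x within {0..1})) \<and>
     in_L2 {0..1} (nth_deriv n f) \<and>
     (\<forall>j<n. nth_deriv j f 0 = 0 \<and> nth_deriv j f 1 = 0)}"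

definition sobolev_inner :: "nat \<Rightarrow> (real \<Rightarrow> complex) \<Rightarrow> (real \<Rightarrow> complex) \<Rightarrow> complex" where
  "sobolev_inner n f g =
     (LINT x|lebesgue_on {0..1}. nth_deriv n f x * cnj (nth_deriv n g x))"

definition g_repr :: "nat \<Rightarrow> nat \<Rightarrow> real \<Rightarrow> real \<Rightarrow> complex" where
  "g_repr n k a = (THE g. g \<in> sobolev0 n \<and>
     (\<forall>f\<in>sobolev0 n. nth_deriv k f a = sobolev_inner n f g))"

definition h_poly :: "nat \<Rightarrow> nat \<Rightarrow> real \<Rightarrow> real \<Rightarrow> real" where
  "h_poly n k x a =
     (\<Sum>l=0..n-1. (-1)^(n-1-l) * real ((2*n-1-k) choose (n-1-l)) * x^(n-1-l) * a^l *
        (\<Sum>m=0..l. real ((n-1+m) choose m) * x^m))"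

end

theory Submission
  imports Defs "HOL-Computational_Algebra.Polynomial_Factorial" "HOL-Computational_Algebra.Field_as_Ring"
begin

text \<open>Both branches of $g_{n,k}$ are polynomials of degree at most $2n-1$, the left one divisible by
  $x^n$ and the right one by $(1-x)^n$, and their difference is
  $(-1)^{n-k-1}(x-a)^{2n-k-1}/(2n-k-1)!$. Integrating $f^{(n)} g_{n,k}^{(n)}$ by parts $n$ times on
  $[0;a]$ and on $[a;1]$ leaves no integral, because the derivatives of order $2n$ vanish, and no
  boundary term at $0$ and $1$; at $a$ the only derivative of $g_{n,k}$ of order between $n$ and
  $2n-1$ with a jump is the one of order $2n-k-1$, which produces exactly $f^{(k)}(a)$.
  Since $f^{(n)}$ exists only almost everywhere, this rests on the fundamental theorem of calculus
  for absolutely continuous functions.\<close>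

section \<open>Absolutely continuous functions\<close>

text \<open>Put N = 2n-k-1. The product a^(n-k) h_{n,k}(x,a) is the Taylor polynomial at 0, cut off
  below x^n, of (a-x)^N (1-x)^(-n): the outer sum of h carries the binomial coefficients of (a-x)^N,
  the inner one those of (1-x)^(-n). Up to scalars, the formula for the difference of the branches
  is a Bezout identity: it writes (x-a)^N as a combination of the coprime polynomials x^n and
  (1-x)^n with cofactors of degree below n. The cofactor of (1-x)^n is determined modulo x^n, where
  (1-x)^n is invertible, and this produces the truncated series; the other cofactor is its mirror
  image under x -> 1-x, a -> 1-a. Existence of the representing function is obtained by exhibiting
  it. Uniqueness holds because an element of the space is recovered from its n-th derivative by
  integrating n times from 0.\<close>

lemma negligible_open_cover:
  fixes N :: "real set"
  assumes "negligible N" "e > 0"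
  obtains U where "open U" "N \<subseteq> U" "U \<in> lmeasurable" "measure lebesgue U < e"
proof -
  have N: "N \<in> null_sets lebesgue"
    using assms(1) by (simp add: negligible_iff_null_sets)
  obtain U where U: "open U" "N \<subseteq> U" "U - N \<in> lmeasurable" "emeasure lebesgue (U - N) < ennreal e"
    using sets_lebesgue_outer_open[of N e] N assms(2) by (auto simp: null_sets_def)
  have "U \<in> lmeasurable"
    using U(1,3) N by (metis borel_open measurable_Diff_null_set sets_completionI_sets sets_lborel)
  moreover have "measure lebesgue U < e"
  proof -
    have "emeasure lebesgue U < ennreal e"
      using U N by (simp add: emeasure_Diff_null_set borel_open)
    then show ?thesis
      using \<open>U \<in> lmeasurable\<close> assms(2) by (simp add: emeasure_eq_measure2 ennreal_less_iff)
  qed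
  ultimately show thesis using that U by blast
qed

lemma absolutely_continuous_on_subset:
  "absolutely_continuous_on S f \<Longrightarrow> T \<subseteq> S \<Longrightarrow> absolutely_continuous_on T f"
  unfolding absolutely_continuous_on_def by (meson order_trans)

text \<open>The Henstock--Kurzweil integral makes the proof direct: intervals tagged in the exceptional
  null set are kept inside an open set of small measure by the gauge, so that absolute continuity
  bounds their contribution, and the other ones are treated as in the classical theorem.\<close>

theorem fundamental_theorem_of_calculus_absolutely_continuous:
  assumes ab: "a \<le> b" and ac: "absolutely_continuous_on {a..b} f" and N: "negligible N"
    and der: "\<And>x. x \<in> {a..b} - N \<Longrightarrow> (f has_vector_derivative f' x) (at x within {a..b})"
  shows "(f' has_integral (f b - f a)) {a..b}"
proof -
  \<comment> \<open>Changing the integrand on a null set keeps the integral; with value 0 on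
    \<open>N\<close>, intervals tagged there contribute only their increments of
    \<open>f\<close>.\<close>
  define h where "h = (\<lambda>x. if x \<in> N then 0 else f' x)"
  have "(h has_integral (f b - f a)) {a..b}"
    unfolding has_integral_real
  proof (intro allI impI)
    fix e :: real assume "e > 0"
    \<comment> \<open>The summand 1 keeps the denominator positive when \<open>a = b\<close> and
      makes the bound on \<open>e1 * (b - a)\<close> strict.\<close>
    define e1 where "e1 = e / (2 * (b - a + 1))"
    have e1: "e1 > 0" "e1 * (b - a) < e / 2"
    proof -
      show "e1 > 0" using \<open>e > 0\<close> ab by (simp add: e1_def)
      have "e1 * (b - a) < e1 * (b - a + 1)" using \<open>e1 > 0\<close> by simp
      also have "\<dots> = e / 2"
        using nonzero_mult_divide_mult_cancel_right[of "b - a + 1" e 2] ab by (simp add: e1_def)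
      finally show "e1 * (b - a) < e / 2" .
    qed
    obtain \<delta> where \<delta>: "\<delta> > 0" "\<And>D T. D division_of T \<Longrightarrow> T \<subseteq> {a..b} \<Longrightarrow> (\<Sum>K\<in>D. Sup K - Inf K) < \<delta>
        \<Longrightarrow> (\<Sum>K\<in>D. norm (f (Sup K) - f (Inf K))) < e / 2"
      using ac \<open>e > 0\<close> unfolding absolutely_continuous_on_def by (metis half_gt_zero)
    obtain U where U: "open U" "N \<subseteq> U" "U \<in> lmeasurable" "measure lebesgue U < \<delta>"
      using negligible_open_cover[OF N \<delta>(1)] by blast
    have "\<forall>x. \<exists>d>0. x \<in> {a..b} - N \<longrightarrow>
         (\<forall>y\<in>{a..b}. norm (y-x) < d \<longrightarrow> norm (f y - f x - (y-x) *\<^sub>R f' x) \<le> e1 * norm (y-x))"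
      using der[unfolded has_vector_derivative_def has_derivative_within_alt] e1(1) by blast
    then obtain d where d: "\<And>x. 0 < d x"
        "\<And>x y. \<lbrakk>x \<in> {a..b} - N; y \<in> {a..b}; norm (y-x) < d x\<rbrakk>
          \<Longrightarrow> norm (f y - f x - (y-x) *\<^sub>R f' x) \<le> e1 * norm (y-x)"
      by metis
    define \<gamma> where "\<gamma> = (\<lambda>x. if x \<in> N then U else ball x (d x))"
    have "gauge \<gamma>"
      using U d(1) by (auto simp: gauge_def \<gamma>_def)
    moreover have "norm ((\<Sum>(x,K)\<in>p. measure lborel K *\<^sub>R h x) - (f b - f a)) < e"
      if ptag: "p tagged_division_of {a..b}" and fine: "\<gamma> fine p" for p
    proof -
      define q where "q = {(x,K)\<in>p. x \<in> N}"
      have "finite p" using ptag by blast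
      have qp: "q \<subseteq> p" by (auto simp: q_def)
      have qpart: "q tagged_partial_division_of {a..b}"
        using ptag qp tagged_partial_division_subset unfolding tagged_division_of_def by blast
      then have qtag: "q tagged_division_of \<Union>(snd ` q)"
        by (rule tagged_partial_division_of_Union_self)
      have qdiv: "(snd ` q) division_of \<Union>(snd ` q)"
        using qtag by (rule division_of_tagged_division)
      have qU: "\<Union>(snd ` q) \<subseteq> U"
        using fine by (fastforce simp: q_def fine_def \<gamma>_def)
      have qab: "\<Union>(snd ` q) \<subseteq> {a..b}"
        using tagged_partial_division_ofD(3)[OF qpart] by fastforce
      have content: "measure lebesgue K = Sup K - Inf K" if K: "K \<in> snd ` q" for K
      proof -
        obtain u v where "K = cbox u v" "K \<noteq> {}"
          using division_ofD(3,4)[OF qdiv K] by blast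
        then show ?thesis by auto
      qed
      have "(\<Sum>K\<in>snd ` q. Sup K - Inf K) = measure lebesgue (\<Union>(snd ` q))"
        using content_division[OF qdiv] content by simp
      also have "\<dots> \<le> measure lebesgue U"
        using lmeasurable_division[OF qdiv] U(3) qU by (intro measure_mono_fmeasurable) auto
      finally have "(\<Sum>K\<in>snd ` q. norm (f (Sup K) - f (Inf K))) < e / 2"
        using \<delta>(2)[OF qdiv qab] U(4) by linarith
      moreover have "(\<Sum>(x,K)\<in>q. norm (f (Sup K) - f (Inf K))) = (\<Sum>K\<in>snd ` q. norm (f (Sup K) - f (Inf K)))"
      proof -
        \<comment> \<open>Passing from tagged pairs to intervals requires a summand that vanishes on
          every interval with empty interior. The empty set is one of them, and \<open>Sup\<close>
          and \<open>Inf\<close> say nothing there, hence the value 0.\<close>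
        let ?d = "\<lambda>K. if K = {} then 0 else norm (f (Sup K) - f (Inf K))"
        have "K \<noteq> {}" if "K \<in> snd ` q" for K
          using division_ofD(3)[OF qdiv that] .
        then have "(\<Sum>(x,K)\<in>q. norm (f (Sup K) - f (Inf K))) = (\<Sum>(x,K)\<in>q. ?d K)"
          "(\<Sum>K\<in>snd ` q. norm (f (Sup K) - f (Inf K))) = (\<Sum>K\<in>snd ` q. ?d K)"
          by (force intro!: sum.cong)+
        moreover have "(\<Sum>(x,K)\<in>q. ?d K) = (\<Sum>K\<in>snd ` q. ?d K)"
        proof (rule sum.over_tagged_division_lemma[OF qtag])
          fix u v :: real assume "box u v = {}"
          then have "v < u \<or> u = v" by auto
          then show "?d (cbox u v) = 0" by auto
        qed
        ultimately show ?thesis by simp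
      qed
      ultimately have q: "(\<Sum>(x,K)\<in>q. norm (f (Sup K) - f (Inf K))) < e / 2" by simp
      have ba: "b - a = (\<Sum>(x,K)\<in>p. Sup K - Inf K)" "f b - f a = (\<Sum>(x,K)\<in>p. f(Sup K) - f(Inf K))"
        using additive_tagged_division_1[OF ab ptag, of "\<lambda>x. x"] additive_tagged_division_1[OF ab ptag, of f]
        by auto
      have len: "0 \<le> Sup K - Inf K" if xK: "(x,K) \<in> p" for x K
      proof -
        obtain u v where "K = cbox u v" "x \<in> K" using ptag xK by blast
        then show ?thesis by auto
      qed
      have "norm (\<Sum>(x,K)\<in>p - q. measure lborel K *\<^sub>R h x - (f (Sup K) - f (Inf K)))
          \<le> (\<Sum>n\<in>p - q. e1 * (case n of (x,K) \<Rightarrow> Sup K - Inf K))"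
      proof (rule sum_norm_le, safe)
        fix x K
        assume xK: "(x, K) \<in> p" "(x, K) \<notin> q"
        then have "x \<in> K" and kab: "K \<subseteq> {a..b}" and "x \<notin> N"
          using ptag by (auto simp: q_def)
        then obtain u v where k: "K = cbox u v"
          using ptag xK(1) by blast
        have "u \<le> v"
          using \<open>x \<in> K\<close> unfolding k by auto
        have ball: "\<forall>y\<in>K. norm (y - x) < d x"
          using fineD[OF fine xK(1)] \<open>x \<notin> N\<close> by (auto simp: \<gamma>_def dist_norm norm_minus_commute)
        have uv: "u \<in> K" "v \<in> K"
          by (simp_all add: \<open>u \<le> v\<close> k)
        have "norm ((v - u) *\<^sub>R f' x - (f v - f u)) =
            norm ((f u - f x - (u - x) *\<^sub>R f' x) - (f v - f x - (v - x) *\<^sub>R f' x))"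
          by (simp add: algebra_simps)
        also have "\<dots> \<le> norm (f u - f x - (u - x) *\<^sub>R f' x) + norm (f v - f x - (v - x) *\<^sub>R f' x)"
          by (rule norm_triangle_ineq4)
        also have "\<dots> \<le> e1 * norm (u - x) + e1 * norm (v - x)"
          using \<open>x \<in> K\<close> uv kab ball \<open>x \<notin> N\<close> by (intro add_mono d(2)) auto
        \<comment> \<open>The tag lies between \<open>u\<close> and \<open>v\<close>, so its
          distances to them add up to the length of the interval.\<close>
        also have "\<dots> = e1 * (v - u)"
          using \<open>x \<in> K\<close> by (auto simp: k field_simps)
        finally show "norm (measure lborel K *\<^sub>R h x - (f (Sup K) - f (Inf K))) \<le> e1 * (Sup K - Inf K)"
          using \<open>u \<le> v\<close> \<open>x \<notin> N\<close> by (simp add: k h_def)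
      qed
      also have "\<dots> \<le> (\<Sum>n\<in>p. e1 * (case n of (x,K) \<Rightarrow> Sup K - Inf K))"
        using \<open>finite p\<close> e1(1) len by (intro sum_mono2) auto
      also have "\<dots> = e1 * (b - a)"
        by (simp add: ba sum_distrib_left)
      also note \<open>e1 * (b - a) < e / 2\<close>
      finally have A: "norm (\<Sum>(x,K)\<in>p - q. measure lborel K *\<^sub>R h x - (f (Sup K) - f (Inf K))) < e / 2" .
      have "norm (\<Sum>(x,K)\<in>q. measure lborel K *\<^sub>R h x - (f (Sup K) - f (Inf K)))
          \<le> (\<Sum>(x,K)\<in>q. norm (f (Sup K) - f (Inf K)))"
        by (rule sum_norm_le) (auto simp: q_def h_def norm_minus_commute)
      with q have B: "norm (\<Sum>(x,K)\<in>q. measure lborel K *\<^sub>R h x - (f (Sup K) - f (Inf K))) < e / 2" by linarith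
      have "(\<Sum>(x,K)\<in>p. measure lborel K *\<^sub>R h x) - (f b - f a)
          = (\<Sum>(x,K)\<in>p. measure lborel K *\<^sub>R h x - (f (Sup K) - f (Inf K)))"
        by (simp add: ba split_def sum_subtractf)
      also have "\<dots> = (\<Sum>(x,K)\<in>p - q. measure lborel K *\<^sub>R h x - (f (Sup K) - f (Inf K)))
          + (\<Sum>(x,K)\<in>q. measure lborel K *\<^sub>R h x - (f (Sup K) - f (Inf K)))"
        using \<open>finite p\<close> qp by (rule sum.subset_diff[rotated])
      finally have "norm ((\<Sum>(x,K)\<in>p. measure lborel K *\<^sub>R h x) - (f b - f a)) < e / 2 + e / 2"
        using norm_triangle_lt[OF add_strict_mono[OF A B]] by (simp only:)
      then show ?thesis by simp
    qed
    ultimately show "\<exists>\<gamma>. gauge \<gamma> \<and> (\<forall>p. p tagged_division_of {a..b} \<and> \<gamma> fine p \<longrightarrow>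
        norm ((\<Sum>(x,K)\<in>p. measure lborel K *\<^sub>R h x) - (f b - f a)) < e)"
      by (intro exI[of _ \<gamma>]) simp
  qed
  then show ?thesis
    by (rule has_integral_spike[OF N, rotated]) (auto simp: h_def)
qed

section \<open>Closure properties of absolute continuity\<close>

lemma division_endpoints:
  fixes K :: "real set"
  assumes "D division_of T" "K \<in> D"
  shows "Inf K \<in> K" "Sup K \<in> K" "Inf K \<le> Sup K" "K \<subseteq> T"
proof -
  obtain u v where "K = cbox u v" "K \<noteq> {}"
    using division_ofD(3,4)[OF assms] by blast
  then show "Inf K \<in> K" "Sup K \<in> K" "Inf K \<le> Sup K" by auto
  show "K \<subseteq> T" using division_ofD(2)[OF assms] .
qed

text \<open>A common comparison principle: Lipschitz functions, sums and products are all handled by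
  dominating the increments of \<open>h\<close> by those of functions already known to be absolutely
  continuous.\<close>

lemma absolutely_continuous_on_estimate:
  assumes f: "absolutely_continuous_on S f" and g: "absolutely_continuous_on S g"
    and h: "\<And>x y. x \<in> S \<Longrightarrow> y \<in> S \<Longrightarrow>
      norm (h y - h x) \<le> A * norm (f y - f x) + B * norm (g y - g x)"
    and AB: "A \<ge> 0" "B \<ge> 0"
  shows "absolutely_continuous_on S h"
  unfolding absolutely_continuous_on_def
proof (intro allI impI)
  fix e :: real assume "e > 0"
  \<comment> \<open>The summand 1 covers the case that \<open>A\<close> and \<open>B\<close> both
    vanish; the factor 2 leaves room for the strict inequality.\<close>
  define e1 where "e1 = e / (2 * (A + B + 1))"
  have AB1: "A + B + 1 > 0" using AB by linarith
  have "e1 > 0" unfolding e1_def using \<open>e > 0\<close> AB1 by (intro divide_pos_pos mult_pos_pos) auto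
  obtain d1 where d1: "d1 > 0" "\<And>D T. D division_of T \<Longrightarrow> T \<subseteq> S \<Longrightarrow> (\<Sum>K\<in>D. Sup K - Inf K) < d1
      \<Longrightarrow> (\<Sum>K\<in>D. norm (f (Sup K) - f (Inf K))) < e1"
    using f \<open>e1 > 0\<close> unfolding absolutely_continuous_on_def by metis
  obtain d2 where d2: "d2 > 0" "\<And>D T. D division_of T \<Longrightarrow> T \<subseteq> S \<Longrightarrow> (\<Sum>K\<in>D. Sup K - Inf K) < d2
      \<Longrightarrow> (\<Sum>K\<in>D. norm (g (Sup K) - g (Inf K))) < e1"
    using g \<open>e1 > 0\<close> unfolding absolutely_continuous_on_def by metis
  show "\<exists>d>0. \<forall>D T. D division_of T \<and> T \<subseteq> S \<and> (\<Sum>K\<in>D. Sup K - Inf K) < d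
      \<longrightarrow> (\<Sum>K\<in>D. norm (h (Sup K) - h (Inf K))) < e"
  proof (intro exI[of _ "min d1 d2"] conjI allI impI)
    show "min d1 d2 > 0" using d1 d2 by simp
    fix D T assume D: "D division_of T \<and> T \<subseteq> S \<and> (\<Sum>K\<in>D. Sup K - Inf K) < min d1 d2"
    have "(\<Sum>K\<in>D. norm (h (Sup K) - h (Inf K)))
        \<le> (\<Sum>K\<in>D. A * norm (f (Sup K) - f (Inf K)) + B * norm (g (Sup K) - g (Inf K)))"
    proof (rule sum_mono)
      fix K assume "K \<in> D"
      then have "Inf K \<in> S" "Sup K \<in> S"
        using division_endpoints[of D T K] D by blast+
      then show "norm (h (Sup K) - h (Inf K)) \<le> A * norm (f (Sup K) - f (Inf K)) + B * norm (g (Sup K) - g (Inf K))"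
        by (rule h)
    qed
    also have "\<dots> = A * (\<Sum>K\<in>D. norm (f (Sup K) - f (Inf K))) + B * (\<Sum>K\<in>D. norm (g (Sup K) - g (Inf K)))"
      by (simp add: sum.distrib sum_distrib_left)
    also have "\<dots> \<le> A * e1 + B * e1"
      using D d1(2)[of D T] d2(2)[of D T] AB by (intro add_mono mult_left_mono) auto
    also have "\<dots> \<le> (A + B + 1) * e1"
      using \<open>e1 > 0\<close> by (simp add: algebra_simps)
    also have "\<dots> < (A + B + 1) * e1 * 2"
      using mult_pos_pos[OF AB1 \<open>e1 > 0\<close>] by linarith
    also have "\<dots> = e"
      using AB1 nonzero_mult_div_cancel_left[of "2 * (A + B + 1)" e] by (simp add: e1_def mult_ac)
    finally show "(\<Sum>K\<in>D. norm (h (Sup K) - h (Inf K))) < e" .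
  qed
qed

text \<open>The comparison function is the embedding of the reals, for which the sum of the
  increments is the total length, so that \<open>d = e\<close> works.\<close>

lemma lipschitz_on_imp_absolutely_continuous_on:
  assumes "L-lipschitz_on S f"
  shows "absolutely_continuous_on S f"
proof -
  have id: "absolutely_continuous_on S of_real"
    unfolding absolutely_continuous_on_def
  proof (intro allI impI)
    fix e :: real assume "e > 0"
    have "(\<Sum>K\<in>D. norm (of_real (Sup K) - of_real (Inf K) :: complex)) = (\<Sum>K\<in>D. Sup K - Inf K)"
      if "D division_of T" for D T
      using division_endpoints(3)[OF that]
      by (intro sum.cong) (simp_all flip: of_real_diff)
    then show "\<exists>d>0. \<forall>D T. D division_of T \<and> T \<subseteq> S \<and> (\<Sum>K\<in>D. Sup K - Inf K) < d
      \<longrightarrow> (\<Sum>K\<in>D. norm (of_real (Sup K) - of_real (Inf K) :: complex)) < e"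
      using \<open>e > 0\<close> by (intro exI[of _ e]) auto
  qed
  show ?thesis
  proof (rule absolutely_continuous_on_estimate[OF id id, of _ L 0])
    show "norm (f y - f x) \<le> L * norm (complex_of_real y - of_real x) + 0 * norm (complex_of_real y - of_real x)"
      if "x \<in> S" "y \<in> S" for x y
      using lipschitz_onD[OF assms that(2,1)] by (simp add: dist_norm flip: of_real_diff)
  qed (use lipschitz_on_nonneg[OF assms] in auto)
qed

lemma absolutely_continuous_on_cong:
  assumes "\<And>x. x \<in> S \<Longrightarrow> f x = g x" and "absolutely_continuous_on S f"
  shows "absolutely_continuous_on S g"
  by (rule absolutely_continuous_on_estimate[OF assms(2) assms(2), of _ 1 0]) (simp_all add: assms(1))

lemma absolutely_continuous_on_const: "absolutely_continuous_on S (\<lambda>x. c)"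
  by (rule lipschitz_on_imp_absolutely_continuous_on[of 0]) (simp add: lipschitz_on_def)

lemma absolutely_continuous_on_add:
  assumes "absolutely_continuous_on S f" "absolutely_continuous_on S g"
  shows "absolutely_continuous_on S (\<lambda>x. f x + g x)"
proof (rule absolutely_continuous_on_estimate[OF assms, of _ 1 1])
  show "norm (f y + g y - (f x + g x)) \<le> 1 * norm (f y - f x) + 1 * norm (g y - g x)" for x y
    using norm_triangle_ineq[of "f y - f x" "g y - g x"] by (simp add: algebra_simps)
qed auto

lemma absolutely_continuous_on_sum:
  assumes "\<And>i. i \<in> I \<Longrightarrow> absolutely_continuous_on S (f i)"
  shows "absolutely_continuous_on S (\<lambda>x. \<Sum>i\<in>I. f i x)"
  using assms
  by (induction I rule: infinite_finite_induct)
    (simp_all add: absolutely_continuous_on_const absolutely_continuous_on_add)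

lemma absolutely_continuous_on_imp_continuous_on:
  assumes "absolutely_continuous_on {a..b} f"
  shows "continuous_on {a..b} f"
  unfolding continuous_on_iff
proof (intro ballI allI impI)
  fix x e :: real assume x: "x \<in> {a..b}" and "e > 0"
  then obtain d where d: "d > 0" "\<And>D T. D division_of T \<Longrightarrow> T \<subseteq> {a..b} \<Longrightarrow> (\<Sum>K\<in>D. Sup K - Inf K) < d
      \<Longrightarrow> (\<Sum>K\<in>D. norm (f (Sup K) - f (Inf K))) < e"
    using assms unfolding absolutely_continuous_on_def by metis
  have "dist (f y) (f x) < e" if y: "y \<in> {a..b}" "dist y x < d" for y
  proof -
    have "{cbox (min x y) (max x y)} division_of cbox (min x y) (max x y)"
      by (intro division_of_self) (simp add: min_def max_def)
    from d(2)[of "{cbox (min x y) (max x y)}", OF this] x y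
    have "norm (f (max x y) - f (min x y)) < e"
      by (auto simp: dist_real_def max_def min_def split: if_splits)
    then show ?thesis
      by (auto simp: dist_norm max_def min_def norm_minus_commute split: if_splits)
  qed
  then show "\<exists>d>0. \<forall>x'\<in>{a..b}. dist x' x < d \<longrightarrow> dist (f x') (f x) < e"
    using d(1) by blast
qed

text \<open>On a compact interval both factors are continuous, hence bounded, and their bounds serve
  as the constants of the comparison principle.\<close>

lemma absolutely_continuous_on_mult:
  assumes f: "absolutely_continuous_on {a..b} f" and g: "absolutely_continuous_on {a..b} g"
  shows "absolutely_continuous_on {a..b} (\<lambda>x. f x * g x)"
proof -
  have bd: "\<exists>B>0. \<forall>x\<in>{a..b}. norm (u x) \<le> B" if "absolutely_continuous_on {a..b} u" for u
    using compact_imp_bounded[OF compact_continuous_image[OF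
      absolutely_continuous_on_imp_continuous_on[OF that] compact_Icc]]
    by (simp add: bounded_pos)
  obtain A B where A: "A > 0" "\<And>x. x \<in> {a..b} \<Longrightarrow> norm (f x) \<le> A"
    and B: "B > 0" "\<And>x. x \<in> {a..b} \<Longrightarrow> norm (g x) \<le> B"
    using bd[OF f] bd[OF g] by blast
  show ?thesis
  proof (rule absolutely_continuous_on_estimate[OF f g])
    fix x y assume xy: "x \<in> {a..b}" "y \<in> {a..b}"
    have "f y * g y - f x * g x = (f y - f x) * g y + f x * (g y - g x)"
      by (simp add: algebra_simps)
    then have "norm (f y * g y - f x * g x) \<le> norm (f y - f x) * norm (g y) + norm (f x) * norm (g y - g x)"
      by (metis norm_mult norm_triangle_ineq)
    also have "\<dots> \<le> norm (f y - f x) * B + A * norm (g y - g x)"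
      using A B xy by (intro add_mono mult_left_mono mult_right_mono) auto
    finally show "norm (f y * g y - f x * g x) \<le> B * norm (f y - f x) + A * norm (g y - g x)"
      by (simp add: mult.commute)
  qed (use A B in auto)
qed

lemma has_vector_derivative_of_real_poly:
  "((\<lambda>x. complex_of_real (poly p x)) has_vector_derivative of_real (poly (pderiv p) x)) (at x within S)"
  by (intro has_vector_derivative_of_real has_vector_derivative_at_within)
    (simp add: poly_DERIV flip: has_real_derivative_iff_has_vector_derivative)

lemma lipschitz_on_of_real_poly:
  "\<exists>L. L-lipschitz_on {a..b} (\<lambda>x. complex_of_real (poly p x))"
proof -
  have "bounded (poly (pderiv p) ` {a..b})"
    by (intro compact_imp_bounded compact_continuous_image continuous_intros) auto
  then obtain C where C: "C > 0" "\<And>x. x \<in> {a..b} \<Longrightarrow> norm (poly (pderiv p) x) \<le> C"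
    by (auto simp: bounded_pos)
  have "C-lipschitz_on {a..b} (\<lambda>x. complex_of_real (poly p x))"
  proof (rule bounded_derivative_imp_lipschitz[where f' = "\<lambda>x t. t *\<^sub>R complex_of_real (poly (pderiv p) x)"])
    show "((\<lambda>x. complex_of_real (poly p x)) has_derivative (\<lambda>t. t *\<^sub>R complex_of_real (poly (pderiv p) x)))
        (at x within {a..b})" for x
      using has_vector_derivative_of_real_poly[of p x "{a..b}"] by (simp add: has_vector_derivative_def)
    show "onorm (\<lambda>t. t *\<^sub>R complex_of_real (poly (pderiv p) x)) \<le> C" if "x \<in> {a..b}" for x
    proof (rule onorm_le)
      fix t :: real
      show "norm (t *\<^sub>R complex_of_real (poly (pderiv p) x)) \<le> C * norm t"
        using mult_right_mono[OF C(2)[OF that], of "\<bar>t\<bar>"] by (simp add: mult.commute)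
    qed
  qed (use C in auto)
  then show ?thesis ..
qed

section \<open>The polynomial identity\<close>

lemma higher_pderiv_diff:
  "(pderiv ^^ n) (p - q) = (pderiv ^^ n) p - (pderiv ^^ n) (q :: real poly)"
  by (induction n arbitrary: p q) (simp_all del: funpow.simps add: funpow_Suc_right pderiv_diff)

lemma higher_pderiv_eq_0:
  fixes p :: "real poly"
  assumes "degree p < n"
  shows "(pderiv ^^ n) p = 0"
  using assms
proof (induction n arbitrary: p)
  case (Suc n)
  show ?case
  proof (cases "degree p = 0")
    case True
    then have "pderiv p = 0" by (simp add: pderiv_eq_0_iff)
    then show ?thesis by (simp add: funpow_Suc_right del: funpow.simps)
  next
    case False
    then have "degree (pderiv p) < n" using Suc.prems by (simp add: degree_pderiv)
    then show ?thesis using Suc.IH by (simp add: funpow_Suc_right del: funpow.simps)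
  qed
qed simp

text \<open>Each differentiation lowers the multiplicity of a root by at most one. This yields the
  boundary conditions at 0 and 1 from the factors x^n and (x-1)^n.\<close>

lemma poly_higher_pderiv_root:
  fixes p :: "real poly"
  assumes "[:-c, 1:] ^ n dvd p" "j < n"
  shows "poly ((pderiv ^^ j) p) c = 0"
  using assms
proof (induction j arbitrary: n p)
  case 0
  then show ?case by (metis dvd_power dvd_trans funpow_0 poly_eq_0_iff_dvd)
next
  case (Suc j)
  then obtain m where n: "n = Suc m" "j < m" by (metis Suc_lessE)
  obtain q where p: "p = [:-c, 1:] ^ Suc m * q" using Suc.prems n by (auto elim: dvdE)
  have "pderiv p = [:-c, 1:] ^ m * (smult (of_nat (Suc m)) q + [:-c, 1:] * pderiv q)"
    by (simp only: p pderiv_mult pderiv_power_Suc) (simp add: pderiv_pCons algebra_simps)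
  then have "[:-c, 1:] ^ m dvd pderiv p" by (rule dvdI)
  from Suc.IH[OF this n(2)] show ?case by (simp add: funpow_Suc_right del: funpow.simps)
qed

text \<open>Since the two branches differ by a multiple of a power of x-a, this computes all jumps
  of derivatives at a.\<close>

lemma poly_higher_pderiv_linear_power:
  "poly ((pderiv ^^ j) ([:-c, 1:] ^ n)) c = (if j = n then fact n else (0 :: real))"
proof (induction j arbitrary: n)
  case 0
  then show ?case by (cases n) auto
next
  case (Suc j)
  show ?case
  proof (cases n)
    case 0
    then show ?thesis by (simp add: funpow_Suc_right del: funpow.simps)
  next
    case (Suc m)
    have "pderiv ([:-c, 1:] ^ Suc m) = smult (real (Suc m)) ([:-c, 1:] ^ m)"
      by (simp only: pderiv_power_Suc) (simp add: pderiv_pCons)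
    then show ?thesis
      using Suc.IH[of m] Suc
      by (simp add: funpow_Suc_right higher_pderiv_smult del: funpow.simps power_Suc of_nat_Suc)
  qed
qed

section \<open>Truncated binomial series and the polynomials h\<close>

text \<open>Multiplication by 1-x takes differences of consecutive coefficients, which Pascal's rule
  evaluates; only the shifted top coefficient has no partner.\<close>

lemma one_minus_times_negative_binomial_sum:
  "(1 - x) * (\<Sum>m=0..l. real ((Suc p + m) choose m) * x ^ m)
    = (\<Sum>m=0..l. real ((p + m) choose m) * x ^ m) - real ((Suc p + l) choose l) * x ^ Suc l"
proof (induction l)
  case (Suc l)
  have "(Suc p + Suc l) choose Suc l = (Suc p + l choose l) + ((p + Suc l) choose Suc l)"
    by simp
  with Suc show ?case by (simp add: algebra_simps del: binomial_Suc_Suc)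
qed simp

text \<open>The sum is a truncation of the power series of $(1-x)^{-n}$.\<close>

lemma truncated_negative_binomial:
  "\<exists>q. \<forall>x::real. (1 - x) ^ Suc p * (\<Sum>m=0..l. real ((p + m) choose m) * x ^ m) = 1 + x ^ Suc l * poly q x"
proof (induction p)
  case 0
  have "(1 - x) * (\<Sum>m=0..l. x ^ m) = 1 - x ^ Suc l" for x :: real
    using sum_gp_basic[of x l] by (simp add: atLeast0AtMost)
  then show ?case by (intro exI[of _ "[:-1:]"]) simp
next
  case (Suc p)
  then obtain q where q: "\<And>x::real. (1 - x) ^ Suc p * (\<Sum>m=0..l. real ((p + m) choose m) * x ^ m)
      = 1 + x ^ Suc l * poly q x" by blast
  show ?case
  \<comment> \<open>The unpaired top term, multiplied by the remaining factor (1-x)^(p+1), is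
    absorbed into the new remainder.\<close>
  proof (intro exI[of _ "q - smult (real ((Suc p + l) choose l)) ([:1, -1:] ^ Suc p)"] allI)
    fix x :: real
    have "(1 - x) ^ Suc (Suc p) * (\<Sum>m=0..l. real ((Suc p + m) choose m) * x ^ m)
      = (1 - x) ^ Suc p * ((1 - x) * (\<Sum>m=0..l. real ((Suc p + m) choose m) * x ^ m))"
      by (simp only: power_Suc2 mult.assoc)
    also have "\<dots> = (1 - x) ^ Suc p * (\<Sum>m=0..l. real ((p + m) choose m) * x ^ m)
        - x ^ Suc l * (real ((Suc p + l) choose l) * (1 - x) ^ Suc p)"
      unfolding one_minus_times_negative_binomial_sum by (simp only: right_diff_distrib mult_ac)
    also have "\<dots> = 1 + x ^ Suc l * poly (q - smult (real ((Suc p + l) choose l)) ([:1, -1:] ^ Suc p)) x"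
      unfolding q by (simp add: poly_power right_diff_distrib del: power_Suc binomial_Suc_Suc)
    finally show "(1 - x) ^ Suc (Suc p) * (\<Sum>m=0..l. real ((Suc p + m) choose m) * x ^ m)
      = 1 + x ^ Suc l * poly (q - smult (real ((Suc p + l) choose l)) ([:1, -1:] ^ Suc p)) x" .
  qed
qed

text \<open>The inner sum stops at l, so each summand has degree at most (n-1-l) + l. This bound
  keeps both branches below degree 2n.\<close>

lemma h_poly_polynomial:
  assumes "n \<ge> 1"
  obtains p :: "real poly" where "degree p \<le> n - 1" "\<And>x. poly p x = h_poly n k x a"
proof
  let ?p = "\<Sum>l=0..n-1. smult ((-1)^(n-1-l) * real ((2*n-1-k) choose (n-1-l)) * a^l)
    (monom 1 (n-1-l) * (\<Sum>m=0..l. monom (real ((n-1+m) choose m)) m))"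
  show "degree ?p \<le> n - 1"
  proof (intro degree_sum_le)
    fix l assume l: "l \<in> {0..n-1}"
    have "degree (monom (1::real) (n-1-l) * (\<Sum>m=0..l. monom (real ((n-1+m) choose m)) m)) \<le> (n-1-l) + l"
      by (intro order_trans[OF degree_mult_le] add_mono degree_monom_le degree_sum_le)
        (auto intro: order_trans[OF degree_monom_le])
    then show "degree (smult ((-1)^(n-1-l) * real ((2*n-1-k) choose (n-1-l)) * a^l)
    (monom 1 (n-1-l) * (\<Sum>m=0..l. monom (real ((n-1+m) choose m)) m))) \<le> n - 1"
      using l by (intro order_trans[OF degree_smult_le]) auto
  qed auto
  show "poly ?p x = h_poly n k x a" for x
    unfolding h_poly_def by (simp add: poly_sum poly_monom mult_ac)
qed

text \<open>Put i = n-1-l. After multiplication by the prefactors, the l-th summand of h is minus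
  the monomial of degree i of (x-a)^N, times (1-x)^n and its inverse series truncated after x^l. The
  last two multiply to 1 plus a multiple of x^(l+1), and i + (l+1) = n puts the error into the ideal
  of x^n. The monomials of degree below n thus cancel.\<close>

lemma h_poly_expansion:
  assumes "n \<ge> 1" "k < n"
  shows "\<exists>q. \<forall>x. (-1)^k * a^(n-k) * (1-x)^n * h_poly n k x a + (x - a)^(2*n-1-k) = x^n * poly q x"
proof -
  define N where "N = 2*n-1-k"
  define c where "c = (\<lambda>i. real (N choose i) * (-a)^(N - i))"
  obtain p where n: "n = Suc p" using assms(1) by (cases n) auto
  obtain Q where Q: "\<And>l x. (1 - x) ^ n * (\<Sum>m=0..l. real ((n-1+m) choose m) * x ^ m) = 1 + x ^ Suc l * poly (Q l) x"
    using truncated_negative_binomial[of p] unfolding n by (metis diff_Suc_1)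
  have coef: "(-1)^k * a^(n-k) * ((-1)^(n-1-l) * real (N choose (n-1-l)) * a^l) = - c (n-1-l)"
    if "l \<le> n - 1" for l
  proof -
    have e: "N - (n-1-l) = (n-k) + l" using that assms by (auto simp: N_def)
    \<comment> \<open>The two exponents add up to the odd number 2n-1, so the signs are
      opposite.\<close>
    have sgn: "(-1)^k * (-1)^(n-1-l) = - ((-1) ^ (n-k+l) :: real)"
    proof -
      have "(-1)^k * (-1)^(n-1-l) = ((-1) ^ (k + (n-1-l)) :: real)" by (simp add: power_add)
      moreover have "even (k + (n-1-l)) \<longleftrightarrow> odd (n-k+l)"
      proof -
        have "Suc ((k + (n-1-l)) + (n-k+l)) = 2 * n" using that assms by linarith
        then have "odd ((k + (n-1-l)) + (n-k+l))" by (metis dvd_triv_left even_Suc)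
        then show ?thesis by (simp only: even_add) blast
      qed
      ultimately show ?thesis by (simp add: minus_one_power_iff)
    qed
    have "(-1)^k * a^(n-k) * ((-1)^(n-1-l) * real (N choose (n-1-l)) * a^l)
        = ((-1)^k * (-1)^(n-1-l)) * (real (N choose (n-1-l)) * (a^(n-k) * a^l))"
      by (simp only: mult_ac)
    also have "\<dots> = - (real (N choose (n-1-l)) * ((-1)^(n-k+l) * a^(n-k+l)))"
      unfolding sgn power_add by simp
    also have "(-1)^(n-k+l) * a^(n-k+l) = (-a)^(n-k+l)"
      by (rule power_minus[symmetric])
    finally show ?thesis unfolding c_def e .
  qed
  have A: "(-1)^k * a^(n-k) * (1-x)^n * h_poly n k x a
      = - (\<Sum>l=0..n-1. c (n-1-l) * x^(n-1-l)) - x^n * (\<Sum>l=0..n-1. c (n-1-l) * poly (Q l) x)" for x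
  proof -
    have "(-1)^k * a^(n-k) * (1-x)^n * h_poly n k x a
      = (\<Sum>l=0..n-1. ((-1)^k * a^(n-k) * ((-1)^(n-1-l) * real (N choose (n-1-l)) * a^l)) * x^(n-1-l) *
          ((1-x)^n * (\<Sum>m=0..l. real ((n-1+m) choose m) * x ^ m)))"
      unfolding h_poly_def N_def[symmetric] sum_distrib_left[of _ _ "{0..n-1}"]
      by (intro sum.cong refl) (simp only: mult_ac)
    also have "\<dots> = (\<Sum>l=0..n-1. - (c (n-1-l) * x^(n-1-l)) - x^n * (c (n-1-l) * poly (Q l) x))"
    proof (intro sum.cong refl)
      fix l assume "l \<in> {0..n-1}"
      then have l: "l \<le> n - 1" by simp
      then have "x ^ n = x^(n-1-l) * x ^ Suc l" using assms by (simp flip: power_add power_Suc)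
      then show "((-1)^k * a^(n-k) * ((-1)^(n-1-l) * real (N choose (n-1-l)) * a^l)) * x^(n-1-l) *
          ((1-x)^n * (\<Sum>m=0..l. real ((n-1+m) choose m) * x ^ m))
          = - (c (n-1-l) * x^(n-1-l)) - x^n * (c (n-1-l) * poly (Q l) x)"
        unfolding Q coef[OF l] by (simp add: algebra_simps)
    qed
    finally show ?thesis by (simp add: sum_subtractf sum_negf sum_distrib_left)
  qed
  have rev: "(\<Sum>l=0..n-1. c (n-1-l) * x^(n-1-l)) = (\<Sum>i<n. c i * x^i)" for x
    using sum.nat_diff_reindex[of "\<lambda>i. c i * x^i" n] assms
    by (simp add: atLeast0AtMost lessThan_Suc_atMost[symmetric])
  have nN: "n \<le> Suc N" using assms by (auto simp: N_def)
  have B: "(x - a)^N = (\<Sum>i<n. c i * x^i) + x^n * (\<Sum>i\<in>{n..N}. c i * x^(i-n))" for x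
  proof -
    have "(x - a)^N = (\<Sum>i\<le>N. c i * x^i)"
      using binomial_ring[of x "-a" N] by (simp add: c_def mult_ac)
    also have "{..N} = {..<n} \<union> {n..N}" using nN by auto
    also have "(\<Sum>i\<in>{..<n} \<union> {n..N}. c i * x^i) = (\<Sum>i<n. c i * x^i) + (\<Sum>i\<in>{n..N}. c i * x^i)"
      by (rule sum.union_disjoint) auto
    also have "(\<Sum>i\<in>{n..N}. c i * x^i) = x^n * (\<Sum>i\<in>{n..N}. c i * x^(i-n))"
      unfolding sum_distrib_left by (intro sum.cong) (auto simp flip: power_add)
    finally show ?thesis .
  qed
  have "(-1)^k * a^(n-k) * (1-x)^n * h_poly n k x a + (x - a)^N
      = x^n * poly ((\<Sum>i\<in>{n..N}. monom (c i) (i-n)) - (\<Sum>l=0..n-1. smult (c (n-1-l)) (Q l))) x" for x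
    unfolding A B rev by (simp add: poly_sum poly_monom right_diff_distrib)
  then show ?thesis unfolding N_def by blast
qed

text \<open>The difference of the two sides is divisible by $x^n$, hence, as it is symmetric under
  $(x, a) \mapsto (1-x, 1-a)$ up to a sign, by $(1-x)^n$, but its degree is less than $2n$.\<close>

lemma h_poly_identity:
  assumes "n \<ge> 1" "k < n"
  shows "(1-a)^(n-k) * x^n * h_poly n k (1-x) (1-a) - (-1)^k * a^(n-k) * (1-x)^n * h_poly n k x a
    = (x - a)^(2*n-1-k)"
proof -
  define N where "N = 2*n-1-k"
  obtain p1 :: "real poly" where p1: "degree p1 \<le> n - 1" "\<And>x. poly p1 x = h_poly n k x (1-a)"
    using h_poly_polynomial[OF assms(1)] by blast
  obtain p2 :: "real poly" where p2: "degree p2 \<le> n - 1" "\<And>x. poly p2 x = h_poly n k x a"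
    using h_poly_polynomial[OF assms(1)] by blast
  define P where "P = smult ((1-a)^(n-k)) ([:0,1:]^n * pcompose p1 [:1,-1:])
      - smult ((-1)^k * a^(n-k)) ([:1,-1:]^n * p2) - [:-a,1:]^N"
  have P: "poly P x = (1-a)^(n-k) * x^n * h_poly n k (1-x) (1-a)
      - (-1)^k * a^(n-k) * (1-x)^n * h_poly n k x a - (x - a)^N" for x
    by (simp add: P_def poly_pcompose p1(2) p2(2) poly_power)
  have "degree P \<le> 2 * n - 1"
  proof -
    have "degree ([:0,1::real:]^n * pcompose p1 [:1,-1:]) \<le> n + (n - 1)"
      using p1(1) by (intro order_trans[OF degree_mult_le] add_mono)
        (auto simp: degree_pcompose intro: order_trans[OF degree_power_le])
    moreover have "degree ([:1,-1::real:]^n * p2) \<le> n + (n - 1)"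
      using p2(1) by (intro order_trans[OF degree_mult_le] add_mono)
        (auto intro: order_trans[OF degree_power_le])
    moreover have "degree ([:-a,1:]^N) \<le> N"
      by (rule order_trans[OF degree_power_le]) simp
    ultimately show ?thesis
      unfolding P_def using assms(1)
      by (intro degree_diff_le order_trans[OF degree_smult_le]) (auto simp: N_def)
  qed
  have "[:0,1:]^n dvd P"
  proof -
    obtain q where q: "\<And>x. (-1)^k * a^(n-k) * (1-x)^n * h_poly n k x a + (x - a)^N = x^n * poly q x"
      using h_poly_expansion[OF assms, of a] unfolding N_def by blast
    have "poly P = poly ([:0,1:]^n * (smult ((1-a)^(n-k)) (pcompose p1 [:1,-1:]) - q))"
    proof
      fix x
      have "poly P x = (1-a)^(n-k) * x^n * h_poly n k (1-x) (1-a) - x^n * poly q x"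
        unfolding P q[symmetric] by simp
      then show "poly P x = poly ([:0,1:]^n * (smult ((1-a)^(n-k)) (pcompose p1 [:1,-1:]) - q)) x"
        by (simp add: poly_power poly_pcompose p1(2) right_diff_distrib mult_ac)
    qed
    then have "P = [:0,1:]^n * (smult ((1-a)^(n-k)) (pcompose p1 [:1,-1:]) - q)"
      by (simp only: poly_eq_poly_eq_iff)
    then show ?thesis by (rule dvdI)
  qed
  moreover have "[:1,-1:]^n dvd P"
  proof -
    \<comment> \<open>The expansion for 1-a will be taken at 1-x, where the linear term becomes
      (1-x)-(1-a) = -(x-a) and x^n becomes (1-x)^n.\<close>
    obtain q where q: "\<And>x. (-1)^k * (1-a)^(n-k) * (1-x)^n * h_poly n k x (1-a) + (x - (1-a))^N = x^n * poly q x"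
      using h_poly_expansion[OF assms, of "1-a"] unfolding N_def by blast
    \<comment> \<open>Here N + k = 2n-1. Because of this sign, multiplying the reflected identity by
      (-1)^k reproduces the terms of \<open>P\<close>.\<close>
    have sgn: "(-1)^N = - ((-1)^k :: real)"
    proof -
      have "odd (N + k)" using assms by (auto simp: N_def)
      then show ?thesis by (auto simp: minus_one_power_iff)
    qed
    have "poly P = poly ([:1,-1:]^n * (smult ((-1)^k) (pcompose q [:1,-1:] - smult (a^(n-k)) p2)))"
    proof
      fix x
      have "((1-x) - (1-a))^N = (-1)^N * (x - a)^N"
        by (simp flip: power_mult_distrib)
      then have "(-1)^k * (1-a)^(n-k) * x^n * h_poly n k (1-x) (1-a) - (-1)^k * (x-a)^N = (1-x)^n * poly q (1-x)"
        using q[of "1-x"] sgn by simp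
      then have "(-1)^k * ((-1)^k * (1-a)^(n-k) * x^n * h_poly n k (1-x) (1-a) - (-1)^k * (x-a)^N)
          = (-1)^k * ((1-x)^n * poly q (1-x))" by (simp only:)
      moreover have "(-1)^k * ((-1)^k * z) = z" for z :: real
        by (simp flip: mult.assoc power_add)
      ultimately have "(1-a)^(n-k) * x^n * h_poly n k (1-x) (1-a) - (x-a)^N
          = (-1)^k * ((1-x)^n * poly q (1-x))"
        by (simp only: right_diff_distrib mult.assoc)
      then have "poly P x = (-1)^k * ((1-x)^n * poly q (1-x)) - (-1)^k * a^(n-k) * (1-x)^n * h_poly n k x a"
        unfolding P by linarith
      then show "poly P x = poly ([:1,-1:]^n * (smult ((-1)^k) (pcompose q [:1,-1:] - smult (a^(n-k)) p2))) x"
        by (simp add: poly_power poly_pcompose p2(2) right_diff_distrib mult_ac)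
    qed
    then have "P = [:1,-1:]^n * (smult ((-1)^k) (pcompose q [:1,-1:] - smult (a^(n-k)) p2))"
      by (simp only: poly_eq_poly_eq_iff)
    then show ?thesis by (rule dvdI)
  qed
  moreover have "coprime ([:0,1:]^n) ([:1,-1::real:]^n)"
  proof -
    have "coprime [:0,1:] [:1,-1::real:]"
    proof (rule coprimeI)
      fix d :: "real poly" assume "d dvd [:0,1:]" "d dvd [:1,-1:]"
      then have "d dvd [:0,1:] + [:1,-1:]" by (rule dvd_add)
      then show "is_unit d" by (simp add: one_pCons)
    qed
    then show ?thesis by simp
  qed
  ultimately have dvd: "[:0,1:]^n * [:1,-1:]^n dvd P"
    by (intro divides_mult)
  have "P = 0"
  proof (rule ccontr)
    assume "P \<noteq> 0"
    then have "degree ([:0,1:]^n * [:1,-1::real:]^n) \<le> degree P"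
      using dvd by (intro dvd_imp_degree_le)
    moreover have "degree ([:0,1:]^n * [:1,-1::real:]^n) = 2 * n"
      by (simp add: degree_mult_eq degree_power_eq)
    ultimately show False using \<open>degree P \<le> 2 * n - 1\<close> assms by linarith
  qed
  then show ?thesis using P[of x] by (simp add: N_def)
qed

section \<open>The Sobolev space\<close>

text \<open>Orders below n-1 are differentiable on all of [0,1] and only order n-1 has exceptions,
  so one null set serves every order.\<close>

lemma sobolev0_has_vector_derivative:
  assumes "f \<in> sobolev0 n"
  obtains N where "negligible N"
    "\<And>j x. j < n \<Longrightarrow> x \<in> {0..1} - N \<Longrightarrow>
      (nth_deriv j f has_vector_derivative nth_deriv (Suc j) f x) (at x within {0..1})"
proof -
  have "AE x in lebesgue_on {0..1}. nth_deriv (n - 1) f differentiable (at x within {0..1})"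
    using assms by (simp add: sobolev0_def)
  then have "AE x in lebesgue. x \<in> {0..1} \<longrightarrow> nth_deriv (n - 1) f differentiable (at x within {0..1})"
    by (simp add: AE_restrict_space_iff)
  then obtain N where N: "N \<in> null_sets lebesgue"
    "{x. \<not> (x \<in> {0..1} \<longrightarrow> nth_deriv (n - 1) f differentiable (at x within {0..1}))} \<subseteq> N"
    by (auto simp: eventually_ae_filter)
  show thesis
  proof
    show "negligible N" using N by (simp add: negligible_iff_null_sets)
    fix j x assume j: "j < n" and x: "x \<in> {0..1} - N"
    have "nth_deriv j f differentiable (at x within {0..1})"
    proof (cases "Suc j < n")
      case True
      then show ?thesis using assms x by (simp add: sobolev0_def)
    next
      case False
      then have "j = n - 1" using j by simp
      then show ?thesis using N x by blast
    qed
    then show "(nth_deriv j f has_vector_derivative nth_deriv (Suc j) f x) (at x within {0..1})"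
      by (simp add: vector_derivative_works)
  qed
qed

text \<open>The value at 0 vanishes, so no constant of integration appears; this is what lets the
  uniqueness proof descend through the orders.\<close>

lemma sobolev0_integral_nth_deriv:
  assumes f: "f \<in> sobolev0 n" and "j < n" and x: "x \<in> {0..1}"
  shows "(nth_deriv (Suc j) f has_integral nth_deriv j f x) {0..x}"
proof -
  obtain N where N: "negligible N"
    "\<And>x. x \<in> {0..1} - N \<Longrightarrow> (nth_deriv j f has_vector_derivative nth_deriv (Suc j) f x) (at x within {0..1})"
    using sobolev0_has_vector_derivative[OF f] \<open>j < n\<close> by metis
  have "(nth_deriv (Suc j) f has_integral nth_deriv j f x - nth_deriv j f 0) {0..x}"
  proof (rule fundamental_theorem_of_calculus_absolutely_continuous[OF _ _ N(1)])
    show "absolutely_continuous_on {0..x} (nth_deriv j f)"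
      using assms by (auto simp: sobolev0_def intro: absolutely_continuous_on_subset[of "{0..1}"])
    show "(nth_deriv j f has_vector_derivative nth_deriv (Suc j) f y) (at y within {0..x})"
      if "y \<in> {0..x} - N" for y
      using that x by (intro has_vector_derivative_within_subset[OF N(2)]) auto
  qed (use x in auto)
  then show ?thesis using assms by (simp add: sobolev0_def)
qed

text \<open>All n integrations by parts at once: \<open>\<Phi>\<close> collects the boundary terms
  and is absolutely continuous, its derivative telescopes almost everywhere to the integrand, and
  the far end of the telescope contains the n-th derivative of \<open>P\<close>, which is 0.\<close>

lemma sobolev0_integration_by_parts:
  assumes f: "f \<in> sobolev0 n" and P: "(pderiv ^^ n) P = 0" and cd: "0 \<le> c" "c \<le> d" "d \<le> 1"
  defines "\<Phi> \<equiv> \<lambda>x. \<Sum>j<n. (-1)^j * nth_deriv (n-1-j) f x * complex_of_real (poly ((pderiv ^^ j) P) x)"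
  shows "((\<lambda>x. nth_deriv n f x * complex_of_real (poly P x)) has_integral \<Phi> d - \<Phi> c) {c..d}"
proof -
  obtain N where N: "negligible N"
    "\<And>j x. j < n \<Longrightarrow> x \<in> {0..1} - N \<Longrightarrow>
      (nth_deriv j f has_vector_derivative nth_deriv (Suc j) f x) (at x within {0..1})"
    using sobolev0_has_vector_derivative[OF f] by metis
  have ac: "absolutely_continuous_on {0..1} \<Phi>"
    unfolding \<Phi>_def
  proof (intro absolutely_continuous_on_sum absolutely_continuous_on_mult absolutely_continuous_on_const)
    fix j assume "j \<in> {..<n}"
    then show "absolutely_continuous_on {0..1} (nth_deriv (n-1-j) f)"
      using f by (auto simp: sobolev0_def)
    show "absolutely_continuous_on {0..1} (\<lambda>x. complex_of_real (poly ((pderiv ^^ j) P) x))"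
      using lipschitz_on_of_real_poly lipschitz_on_imp_absolutely_continuous_on by blast
  qed
  have der: "(\<Phi> has_vector_derivative nth_deriv n f x * complex_of_real (poly P x)) (at x within {0..1})"
    if x: "x \<in> {0..1} - N" for x
  proof -
    \<comment> \<open>The derivative of \<open>f\<close> has order n-j here, one more than in the
      j-th term of \<open>\<Phi>\<close>; the product rule then gives
      \<open>t j - t (Suc j)\<close>.\<close>
    define t where "t = (\<lambda>j. (-1)^j * nth_deriv (n-j) f x * complex_of_real (poly ((pderiv ^^ j) P) x))"
    have "(\<Phi> has_vector_derivative (\<Sum>j<n. t j - t (Suc j))) (at x within {0..1})"
      unfolding \<Phi>_def
    proof (rule has_vector_derivative_sum)
      fix j assume j: "j \<in> {..<n}"
      then have e: "Suc (n - 1 - j) = n - j" "n - 1 - j < n" by auto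
      have "((\<lambda>x. ((-1)^j * nth_deriv (n-1-j) f x) * complex_of_real (poly ((pderiv ^^ j) P) x)) has_vector_derivative
          ((-1)^j * nth_deriv (n-1-j) f x) * complex_of_real (poly (pderiv ((pderiv ^^ j) P)) x)
          + ((-1)^j * nth_deriv (Suc (n-1-j)) f x) * complex_of_real (poly ((pderiv ^^ j) P) x))
          (at x within {0..1})"
        by (intro has_vector_derivative_mult has_vector_derivative_of_real_poly
            has_vector_derivative_mult_right N(2) e x)
      then show "((\<lambda>x. (-1)^j * nth_deriv (n-1-j) f x * complex_of_real (poly ((pderiv ^^ j) P) x))
          has_vector_derivative t j - t (Suc j)) (at x within {0..1})"
        unfolding e(1) t_def by (simp add: add.commute)
    qed
    also have "(\<Sum>j<n. t j - t (Suc j)) = t 0 - t n"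
      by (rule sum_lessThan_telescope')
    finally show ?thesis by (simp add: t_def P)
  qed
  show ?thesis
  proof (rule fundamental_theorem_of_calculus_absolutely_continuous[OF cd(2) _ N(1)])
    show "absolutely_continuous_on {c..d} \<Phi>"
      using ac cd by (auto intro: absolutely_continuous_on_subset)
    show "(\<Phi> has_vector_derivative nth_deriv n f x * complex_of_real (poly P x)) (at x within {c..d})"
      if "x \<in> {c..d} - N" for x
      using that cd by (intro has_vector_derivative_within_subset[OF der]) auto
  qed
qed

section \<open>Uniqueness of the representing function\<close>

text \<open>The Bochner integral is 0 by default on non-integrable functions, so inner products can
  be combined linearly only once this is known.\<close>

lemma in_L2_integrable_mult_cnj:
  assumes "in_L2 S f" "in_L2 S g"
  shows "integrable (lebesgue_on S) (\<lambda>x. f x * cnj (g x))"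
proof (rule Bochner_Integration.integrable_bound)
  show "integrable (lebesgue_on S) (\<lambda>x. (norm (f x))\<^sup>2 + (norm (g x))\<^sup>2)"
    using assms by (simp add: in_L2_def)
  have [measurable]: "f \<in> borel_measurable (lebesgue_on S)" "g \<in> borel_measurable (lebesgue_on S)"
    using assms by (simp_all add: in_L2_def)
  have "(\<lambda>x. cnj (g x)) \<in> borel_measurable (lebesgue_on S)"
    by (rule measurable_compose[OF _ borel_measurable_continuous_onI[of cnj]])
      (auto intro: continuous_intros)
  then show "(\<lambda>x. f x * cnj (g x)) \<in> borel_measurable (lebesgue_on S)"
    by measurable
  have "norm (f x) * norm (g x) \<le> (norm (f x))\<^sup>2 + (norm (g x))\<^sup>2" for x
  proof -
    have "0 \<le> norm (f x) * norm (g x)" by simp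
    with sum_squares_bound[of "norm (f x)" "norm (g x)"] show ?thesis
      unfolding mult.assoc by linarith
  qed
  then show "AE x in lebesgue_on S. norm (f x * cnj (g x)) \<le> norm ((norm (f x))\<^sup>2 + (norm (g x))\<^sup>2)"
    by (simp add: norm_mult)
qed

text \<open>Expanding $(f-g,f-g)$ into four inner products avoids showing that the space is closed under
  differences.\<close>

lemma sobolev0_eqI:
  assumes f: "f \<in> sobolev0 n" and g: "g \<in> sobolev0 n" and n: "n \<ge> 1"
    and eq: "sobolev_inner n f f = sobolev_inner n f g" "sobolev_inner n g f = sobolev_inner n g g"
  shows "f = g"
proof -
  let ?M = "lebesgue_on {0..1::real}" and ?F = "nth_deriv n f" and ?G = "nth_deriv n g"
  have L2: "in_L2 {0..1} ?F" "in_L2 {0..1} ?G"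
    using f g by (simp_all add: sobolev0_def)
  note int = in_L2_integrable_mult_cnj[OF L2(1) L2(1)] in_L2_integrable_mult_cnj[OF L2(1) L2(2)]
    in_L2_integrable_mult_cnj[OF L2(2) L2(1)] in_L2_integrable_mult_cnj[OF L2(2) L2(2)]
  have sq: "complex_of_real ((norm (?F x - ?G x))\<^sup>2)
      = (?F x * cnj (?F x) - ?F x * cnj (?G x)) - (?G x * cnj (?F x) - ?G x * cnj (?G x))" for x
    by (simp add: complex_norm_square algebra_simps del: of_real_power)
  have int': "integrable ?M (\<lambda>x. complex_of_real ((norm (?F x - ?G x))\<^sup>2))"
    unfolding sq using int by (intro Bochner_Integration.integrable_diff)
  have "complex_of_real (LINT x|?M. (norm (?F x - ?G x))\<^sup>2)
      = (LINT x|?M. complex_of_real ((norm (?F x - ?G x))\<^sup>2))"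
    by (rule integral_complex_of_real[symmetric])
  also have "\<dots> = (sobolev_inner n f f - sobolev_inner n f g) - (sobolev_inner n g f - sobolev_inner n g g)"
    unfolding sq sobolev_inner_def using int
    by (simp add: Bochner_Integration.integral_diff Bochner_Integration.integrable_diff)
  finally have "(LINT x|?M. (norm (?F x - ?G x))\<^sup>2) = 0"
    using eq by simp
  moreover have "integrable ?M (\<lambda>x. (norm (?F x - ?G x))\<^sup>2)"
    using int' by (simp add: complex_of_real_integrable_eq del: of_real_power)
  ultimately have "AE x in ?M. (norm (?F x - ?G x))\<^sup>2 = 0"
    by (subst (asm) integral_nonneg_eq_0_iff_AE) auto
  then have "AE x in lebesgue. x \<in> {0..1} \<longrightarrow> ?F x = ?G x"
    by (simp add: AE_restrict_space_iff)
  then obtain N where "N \<in> null_sets lebesgue" and N: "\<And>x. x \<in> {0..1} - N \<Longrightarrow> ?F x = ?G x"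
    by (auto simp: eventually_ae_filter)
  then have neg: "negligible N" by (simp add: negligible_iff_null_sets)
  \<comment> \<open>Integration ignores null sets, so agreement almost everywhere at order j+1
    becomes agreement everywhere at order j.\<close>
  have descend: "nth_deriv j f x = nth_deriv j g x"
    if "j < n" "x \<in> {0..1}" "negligible N" "\<And>x. x \<in> {0..1} - N \<Longrightarrow> nth_deriv (Suc j) f x = nth_deriv (Suc j) g x"
    for j x N
  proof (rule has_integral_unique)
    show "(nth_deriv (Suc j) f has_integral nth_deriv j f x) {0..x}"
      by (rule sobolev0_integral_nth_deriv[OF f that(1,2)])
    show "(nth_deriv (Suc j) f has_integral nth_deriv j g x) {0..x}"
      by (rule has_integral_spike[OF that(3) _ sobolev0_integral_nth_deriv[OF g that(1,2)]])
        (use that(2,4) in auto)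
  qed
  have ae: "\<exists>N. negligible N \<and> (\<forall>x\<in>{0..1} - N. nth_deriv j f x = nth_deriv j g x)" if "j \<le> n" for j
    using that
  proof (induction j rule: inc_induct)
    case base
    then show ?case using neg N by blast
  next
    case (step j)
    then obtain N where N: "negligible N" "\<And>x. x \<in> {0..1} - N \<Longrightarrow> nth_deriv (Suc j) f x = nth_deriv (Suc j) g x"
      by blast
    show ?case
      using descend[OF step.hyps(2) _ N] by (intro exI[of _ "{}"]) simp
  qed
  \<comment> \<open>At order 0 the statement \<open>ae\<close> still allows a null set of
    exceptions; starting from order 1, one more descent removes it.\<close>
  obtain N1 where N1: "negligible N1" "\<And>x. x \<in> {0..1} - N1 \<Longrightarrow> nth_deriv (Suc 0) f x = nth_deriv (Suc 0) g x"
    using ae[of "Suc 0"] n by auto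
  have "f x = g x" if x: "x \<in> {0..1}" for x
    using descend[OF _ x N1] n by simp
  moreover have "f \<in> extensional {0..1}" "g \<in> extensional {0..1}"
    using f g by (simp_all add: sobolev0_def)
  ultimately show ?thesis by (intro extensionalityI)
qed

section \<open>The representing function\<close>

text \<open>The shape is preserved by differentiation: while the polynomials and their slopes agree
  at \<open>a\<close>, the derivative is again a \<open>glue\<close>. The choice of \<open>L\<close>
  at \<open>a\<close> itself matters only once the two polynomials disagree there.\<close>

definition glue :: "real \<Rightarrow> real poly \<Rightarrow> real poly \<Rightarrow> real \<Rightarrow> complex" where
  "glue a L R x = complex_of_real (if x \<le> a then poly L x else poly R x)"

text \<open>Equality of the slopes is asked for only when \<open>x = a\<close>, so the passage to
  order n, where the slopes may differ, is covered at all other points.\<close>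

lemma glue_has_vector_derivative:
  assumes a: "a \<in> {0<..<1}" and eq: "poly L a = poly R a" and x: "x \<in> {0..1}"
    and eq': "x = a \<Longrightarrow> poly (pderiv L) a = poly (pderiv R) a"
  shows "(glue a L R has_vector_derivative glue a (pderiv L) (pderiv R) x) (at x within {0..1})"
proof -
  let ?l = "\<lambda>p x. complex_of_real (poly p x)"
  have "((\<lambda>x. if x \<in> {0..a} then ?l L x else ?l R x) has_vector_derivative
      (if x \<in> {0..a} then ?l (pderiv L) x else ?l (pderiv R) x)) (at x within {0..1})"
  proof (rule has_vector_derivative_If_within_closures[where T = "{a..1}"])
    show "?l (pderiv L) x = ?l (pderiv R) x" if "x \<in> closure {0..a}" "x \<in> closure {a..1}"
    proof -
      have "x = a" using that by simp
      with eq' show ?thesis by simp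
    qed
  qed (use a x eq in \<open>auto intro: has_vector_derivative_of_real_poly\<close>)
  also have "(if x \<in> {0..a} then ?l (pderiv L) x else ?l (pderiv R) x) = glue a (pderiv L) (pderiv R) x"
    using x by (simp add: glue_def)
  finally show ?thesis
    by (rule has_vector_derivative_transform[rotated 2]) (use x in \<open>auto simp: glue_def\<close>)
qed

text \<open>The point \<open>a\<close> is excluded at order n because the one-sided derivatives may
  differ there and \<open>nth_deriv\<close> then has an arbitrary value.\<close>

lemma nth_deriv_glue:
  assumes a: "a \<in> {0<..<1}"
    and eq: "\<And>j. j < n \<Longrightarrow> poly ((pderiv ^^ j) L) a = poly ((pderiv ^^ j) R) a"
    and "j \<le> n" "x \<in> {0..1}" "j < n \<or> x \<noteq> a"
  shows "nth_deriv j (restrict (glue a L R) {0..1}) x = glue a ((pderiv ^^ j) L) ((pderiv ^^ j) R) x"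
  using assms(3-)
proof (induction j arbitrary: x)
  case 0
  then show ?case by simp
next
  case (Suc j)
  let ?g = "glue a ((pderiv ^^ j) L) ((pderiv ^^ j) R)"
  \<comment> \<open>Order j is still below n, so this holds on the whole interval including
    \<open>a\<close>, as needed to transfer the derivative.\<close>
  have IH: "nth_deriv j (restrict (glue a L R) {0..1}) y = ?g y" if "y \<in> {0..1}" for y
    by (rule Suc.IH) (use that Suc.prems(1) in simp_all)
  have "(?g has_vector_derivative glue a (pderiv ((pderiv ^^ j) L)) (pderiv ((pderiv ^^ j) R)) x) (at x within {0..1})"
    using eq[of j] eq[of "Suc j"] Suc.prems a by (intro glue_has_vector_derivative) auto
  then have "(nth_deriv j (restrict (glue a L R) {0..1}) has_vector_derivative
      glue a (pderiv ((pderiv ^^ j) L)) (pderiv ((pderiv ^^ j) R)) x) (at x within {0..1})"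
    by (rule has_vector_derivative_transform[OF Suc.prems(2), rotated]) (rule IH)
  then have "vector_derivative (nth_deriv j (restrict (glue a L R) {0..1})) (at x within {0..1})
      = glue a (pderiv ((pderiv ^^ j) L)) (pderiv ((pderiv ^^ j) R)) x"
    using Suc.prems by (intro vector_derivative_within_closed_interval) auto
  then show ?case by (simp only: nth_deriv.simps funpow.simps o_apply)
qed

lemma nth_deriv_glue_differentiable:
  assumes a: "a \<in> {0<..<1}"
    and eq: "\<And>j. j < n \<Longrightarrow> poly ((pderiv ^^ j) L) a = poly ((pderiv ^^ j) R) a"
    and j: "j < n" and x: "x \<in> {0..1}" and "Suc j < n \<or> x \<noteq> a"
  shows "nth_deriv j (restrict (glue a L R) {0..1}) differentiable (at x within {0..1})"
proof -
  let ?g = "glue a ((pderiv ^^ j) L) ((pderiv ^^ j) R)"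
  have "(?g has_vector_derivative glue a (pderiv ((pderiv ^^ j) L)) (pderiv ((pderiv ^^ j) R)) x) (at x within {0..1})"
    using eq[of j] eq[of "Suc j"] assms by (intro glue_has_vector_derivative) auto
  then have "(nth_deriv j (restrict (glue a L R) {0..1}) has_vector_derivative
      glue a (pderiv ((pderiv ^^ j) L)) (pderiv ((pderiv ^^ j) R)) x) (at x within {0..1})"
    by (rule has_vector_derivative_transform[OF x, rotated])
      (rule nth_deriv_glue[OF a eq less_imp_le[OF j] _ disjI1[OF j]])
  then show ?thesis by (auto intro: differentiableI_vector)
qed

text \<open>The value at \<open>a\<close> is left free in view of the n-th derivative, which may
  fail to exist there; one point affects neither measurability nor boundedness.\<close>

lemma in_L2_glue:
  assumes a: "a \<in> {0<..<1}" and u: "\<And>x. x \<in> {0..1} \<Longrightarrow> x \<noteq> a \<Longrightarrow> u x = glue a L R x"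
  shows "in_L2 {0..1} u"
proof -
  define v where "v = (\<lambda>x. if x = a then u a else glue a L R x)"
  have uv: "u x = v x" if "x \<in> {0..1}" for x using u[OF that] by (simp add: v_def)
  have [measurable]: "poly p \<in> borel_measurable borel" for p :: "real poly"
    by (intro borel_measurable_continuous_onI continuous_intros)
  have "glue a L R \<in> borel_measurable borel"
    unfolding glue_def[abs_def] by measurable
  then have "v \<in> borel_measurable borel"
    unfolding v_def by measurable
  then have "v \<in> borel_measurable (lebesgue_on {0..1})"
    by (intro measurable_restrict_space1 measurable_completion) simp
  then have meas: "u \<in> borel_measurable (lebesgue_on {0..1})"
    by (rule measurable_cong[THEN iffD1, rotated]) (simp add: uv)
  have "bounded (poly L ` {0..1})" "bounded (poly R ` {0..1})"
    by (intro compact_imp_bounded compact_continuous_image continuous_intros; simp)+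
  then obtain A B where "\<forall>y\<in>poly L ` {0..1}. norm y \<le> A" "\<forall>y\<in>poly R ` {0..1}. norm y \<le> B"
    unfolding bounded_iff by blast
  then have A: "\<bar>poly L x\<bar> \<le> A" and B: "\<bar>poly R x\<bar> \<le> B" if "x \<in> {0..1}" for x
    using that by auto
  have bd: "norm (u x) \<le> max (norm (u a)) (max A B)" if "x \<in> {0..1}" for x
    using A[OF that] B[OF that] u[OF that] by (cases "x = a") (auto simp: glue_def)
  interpret finite_measure "lebesgue_on {0..1::real}"
    by (rule finite_measure_lebesgue_on) simp
  have "integrable (lebesgue_on {0..1}) (\<lambda>x. (norm (u x))\<^sup>2)"
  proof (rule integrable_const_bound)
    show "AE x in lebesgue_on {0..1}. norm ((norm (u x))\<^sup>2) \<le> (max (norm (u a)) (max A B))\<^sup>2"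
      using bd by (auto intro!: AE_I2 power_mono)
    show "(\<lambda>x. (norm (u x))\<^sup>2) \<in> borel_measurable (lebesgue_on {0..1})"
      using meas by measurable
  qed
  with meas show ?thesis by (simp add: in_L2_def)
qed

lemma glue_in_sobolev0:
  assumes a: "a \<in> {0<..<1}" and n: "n \<ge> 1"
    and eq: "\<And>j. j < n \<Longrightarrow> poly ((pderiv ^^ j) L) a = poly ((pderiv ^^ j) R) a"
    and L: "[:0, 1:] ^ n dvd L" and R: "[:-1, 1:] ^ n dvd R"
  shows "restrict (glue a L R) {0..1} \<in> sobolev0 n"
proof -
  let ?G = "restrict (glue a L R) {0..1}"
  note D = nth_deriv_glue[where n = n, OF a eq]
  note diff = nth_deriv_glue_differentiable[where n = n, OF a eq]
  have "absolutely_continuous_on {0..1} (nth_deriv j ?G)" if j: "j < n" for j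
  proof -
    let ?L = "\<lambda>x. complex_of_real (poly ((pderiv ^^ j) L) x)" and ?R = "\<lambda>x. complex_of_real (poly ((pderiv ^^ j) R) x)"
    obtain A B where "A-lipschitz_on {0..a} ?L" "B-lipschitz_on {a..1} ?R"
      using lipschitz_on_of_real_poly by metis
    then have "(max A B)-lipschitz_on {0..1} (\<lambda>x. if x \<le> a then ?L x else ?R x)"
      using eq[OF j] by (intro lipschitz_on_concat_max) auto
    then have "absolutely_continuous_on {0..1} (\<lambda>x. if x \<le> a then ?L x else ?R x)"
      by (rule lipschitz_on_imp_absolutely_continuous_on)
    then show ?thesis
      by (rule absolutely_continuous_on_cong[rotated]) (use j in \<open>simp add: D glue_def\<close>)
  qed
  moreover have "AE x in lebesgue_on {0..1}. nth_deriv (n - 1) ?G differentiable (at x within {0..1})"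
  proof (rule AE_I)
    show "{x \<in> space (lebesgue_on {0..1}). \<not> nth_deriv (n - 1) ?G differentiable (at x within {0..1})} \<subseteq> {a}"
      using diff[of "n - 1"] n by auto
    show "{a} \<in> sets (lebesgue_on {0..1})" "emeasure (lebesgue_on {0..1}) {a} = 0"
      using a by (simp_all add: sets_restrict_space_iff emeasure_restrict_space)
  qed
  moreover have "in_L2 {0..1} (nth_deriv n ?G)"
    by (rule in_L2_glue[OF a]) (simp add: D)
  moreover have "nth_deriv j ?G 0 = 0" "nth_deriv j ?G 1 = 0" if j: "j < n" for j
    using D[of j 0] D[of j 1] poly_higher_pderiv_root[of 0 n L j] poly_higher_pderiv_root[of 1 n R j] L R j a
    by (auto simp: glue_def)
  ultimately show ?thesis
    using diff unfolding sobolev0_def by auto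
qed

section \<open>The reproducing property\<close>

lemma sobolev_inner_glue:
  assumes a: "a \<in> {0<..<1}" and f: "f \<in> sobolev0 n"
    and eq: "\<And>j. j < n \<Longrightarrow> poly ((pderiv ^^ j) L) a = poly ((pderiv ^^ j) R) a"
    and L: "[:0, 1:] ^ n dvd L" "degree L < 2 * n" and R: "[:-1, 1:] ^ n dvd R" "degree R < 2 * n"
  shows "sobolev_inner n f (restrict (glue a L R) {0..1})
    = (\<Sum>j<n. (-1)^j * nth_deriv (n-1-j) f a * complex_of_real (poly ((pderiv ^^ (n+j)) (L - R)) a))"
proof -
  let ?G = "restrict (glue a L R) {0..1}"
  have n: "n \<ge> 1" using L(2) by (cases n) auto
  define \<Phi> where "\<Phi> = (\<lambda>P x. \<Sum>j<n. (-1)^j * nth_deriv (n-1-j) f x * complex_of_real (poly ((pderiv ^^ j) P) x))"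
  \<comment> \<open>Every term contains a derivative of \<open>f\<close> of order below n, which
    vanishes at both ends.\<close>
  have ends: "\<Phi> P 0 = 0" "\<Phi> P 1 = 0" for P
    using f n by (auto simp: \<Phi>_def sobolev0_def intro!: sum.neutral)
  have top: "(pderiv ^^ n) ((pderiv ^^ n) P) = 0" if "degree P < 2 * n" for P :: "real poly"
    using higher_pderiv_eq_0[OF that] by (simp add: mult_2 funpow_add)
  have parts: "((\<lambda>x. nth_deriv n f x * complex_of_real (poly ((pderiv ^^ n) P) x)) has_integral
      \<Phi> ((pderiv ^^ n) P) d - \<Phi> ((pderiv ^^ n) P) c) {c..d}"
    if "degree P < 2 * n" "0 \<le> c" "c \<le> d" "d \<le> 1" for P c d
    unfolding \<Phi>_def by (rule sobolev0_integration_by_parts[OF f top[OF that(1)] that(2-)])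
  have D: "nth_deriv n ?G x = complex_of_real (if x \<le> a then poly ((pderiv ^^ n) L) x else poly ((pderiv ^^ n) R) x)"
    if "x \<in> {0..1}" "x \<noteq> a" for x
    using nth_deriv_glue[where n = n and j = n, OF a eq, of x] that by (simp add: glue_def)
  let ?h = "\<lambda>x. nth_deriv n f x * cnj (nth_deriv n ?G x)"
  \<comment> \<open>The conjugation disappears because the glued function is real, and the unknown
    value of its n-th derivative at \<open>a\<close> is discarded as a single point.\<close>
  have left: "(?h has_integral \<Phi> ((pderiv ^^ n) L) a) {0..a}"
    using parts[OF L(2), of 0 a] a
    by (intro has_integral_spike_finite[of "{a}" "{0..a}" ?h]) (auto simp: D ends)
  have right: "(?h has_integral - \<Phi> ((pderiv ^^ n) R) a) {a..1}"
    using parts[OF R(2), of a 1] a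
    by (intro has_integral_spike_finite[of "{a}" "{a..1}" ?h]) (auto simp: D ends)
  have "(?h has_integral \<Phi> ((pderiv ^^ n) L) a + - \<Phi> ((pderiv ^^ n) R) a) {0..1}"
    using a by (intro has_integral_combine[OF _ _ left right]) auto
  \<comment> \<open>Integration by parts was done for the gauge integral; integrability of the
    product identifies it with the Lebesgue integral in \<open>sobolev_inner\<close>.\<close>
  moreover have "(?h has_integral sobolev_inner n f ?G) {0..1}"
    unfolding sobolev_inner_def
    using f glue_in_sobolev0[OF a n eq L(1) R(1)]
    by (intro has_integral_integral_lebesgue_on in_L2_integrable_mult_cnj) (auto simp: sobolev0_def)
  ultimately have "sobolev_inner n f ?G = \<Phi> ((pderiv ^^ n) L) a - \<Phi> ((pderiv ^^ n) R) a"
    by (simp add: has_integral_unique)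
  also have "\<dots> = (\<Sum>j<n. (-1)^j * nth_deriv (n-1-j) f a * complex_of_real (poly ((pderiv ^^ (n+j)) (L - R)) a))"
    unfolding \<Phi>_def
    by (simp add: higher_pderiv_diff algebra_simps flip: sum_subtractf) (simp add: funpow_add add.commute[of n])
  finally show ?thesis .
qed

lemma glue_reproduces_derivative:
  assumes a: "a \<in> {0<..<1}" and k: "k < n" and f: "f \<in> sobolev0 n"
    and L: "[:0, 1:] ^ n dvd L" "degree L < 2 * n" and R: "[:-1, 1:] ^ n dvd R" "degree R < 2 * n"
    and LR: "L - R = smult ((-1)^(n-k-1) / fact (2*n-k-1)) ([:-a, 1:] ^ (2*n-k-1))"
  shows "restrict (glue a L R) {0..1} \<in> sobolev0 n"
    and "sobolev_inner n f (restrict (glue a L R) {0..1}) = nth_deriv k f a"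
proof -
  define N where "N = 2*n-k-1"
  have jump: "poly ((pderiv ^^ j) (L - R)) a = (if j = N then (-1)^(n-k-1) else 0)" for j
    unfolding LR N_def[symmetric] by (simp add: higher_pderiv_smult poly_higher_pderiv_linear_power)
  have eq: "poly ((pderiv ^^ j) L) a = poly ((pderiv ^^ j) R) a" if "j < n" for j
  proof -
    have "j \<noteq> N" using that k unfolding N_def by linarith
    then show ?thesis using jump[of j] by (simp add: higher_pderiv_diff)
  qed
  show "restrict (glue a L R) {0..1} \<in> sobolev0 n"
    using k by (intro glue_in_sobolev0 a eq L(1) R(1)) auto
  have "sobolev_inner n f (restrict (glue a L R) {0..1})
      = (\<Sum>j<n. (-1)^j * nth_deriv (n-1-j) f a * complex_of_real (poly ((pderiv ^^ (n+j)) (L - R)) a))"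
    by (rule sobolev_inner_glue[OF a f _ L R]) (rule eq)
  \<comment> \<open>Only j = n-1-k satisfies n+j = N. Its sign from the integrations by parts equals
    the sign in front of the power of x-a, so the two cancel; the factorial has already cancelled in
    \<open>jump\<close>.\<close>
  also have "\<dots> = (\<Sum>j<n. if j = n-1-k then (-1)^j * nth_deriv (n-1-j) f a * (-1)^(n-k-1) else 0)"
    by (intro sum.cong refl) (use k in \<open>auto simp: jump N_def\<close>)
  also have "\<dots> = (-1)^(n-1-k) * nth_deriv (n-1-(n-1-k)) f a * (-1)^(n-k-1)"
    using k by simp
  also have "\<dots> = nth_deriv k f a"
  proof -
    have e: "n-1-k = n-k-1" "n-1-(n-k-1) = k" using k by auto
    have "(-1)^m * z * (-1)^m = z" for m and z :: complex
      by (simp add: minus_one_power_iff)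
    then show ?thesis unfolding e .
  qed
  finally show "sobolev_inner n f (restrict (glue a L R) {0..1}) = nth_deriv k f a" .
qed

theorem mainTheorem1:
  fixes n k :: nat and a :: real
  assumes "n \<ge> 1" and "k \<le> n - 1" and "a \<in> {0<..<1}"
  shows "(\<exists>!g. g \<in> sobolev0 n \<and> (\<forall>f\<in>sobolev0 n. nth_deriv k f a = sobolev_inner n f g)) \<and>
    (\<forall>x\<in>{0..a}. g_repr n k a x = complex_of_real
        ((-1)^(n-k-1) / fact (2*n-k-1) * (1-a)^(n-k) * x^n * h_poly n k (1-x) (1-a))) \<and>
    (\<forall>x\<in>{a..1}. g_repr n k a x = complex_of_real
        ((-1)^(n-1) / fact (2*n-k-1) * a^(n-k) * (1-x)^n * h_poly n k x a))"
proof -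
  have k: "k < n" using assms by linarith
  obtain p1 :: "real poly" where p1: "degree p1 \<le> n - 1" "\<And>x. poly p1 x = h_poly n k x (1-a)"
    using h_poly_polynomial[OF assms(1)] by blast
  obtain p2 :: "real poly" where p2: "degree p2 \<le> n - 1" "\<And>x. poly p2 x = h_poly n k x a"
    using h_poly_polynomial[OF assms(1)] by blast
  define L where "L = [:0, 1:] ^ n * smult ((-1)^(n-k-1) / fact (2*n-k-1) * (1-a)^(n-k)) (pcompose p1 [:1, -1:])"
  \<comment> \<open>The extra sign (-1)^n turns (x-1)^n into the (1-x)^n of the formula, while the
    factor x-1 has the form expected by the root lemma.\<close>
  define R where "R = [:-1, 1:] ^ n * smult ((-1)^n * ((-1)^(n-1) / fact (2*n-k-1) * a^(n-k))) p2"
  define G where "G = restrict (glue a L R) {0..1}"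
  have polyL: "poly L x = (-1)^(n-k-1) / fact (2*n-k-1) * (1-a)^(n-k) * x^n * h_poly n k (1-x) (1-a)" for x
    by (simp add: L_def poly_power poly_pcompose p1(2))
  have polyR: "poly R x = (-1)^(n-1) / fact (2*n-k-1) * a^(n-k) * (1-x)^n * h_poly n k x a" for x
  proof -
    have "(x - 1)^n * (-1)^n = (1-x)^n" by (simp flip: power_mult_distrib)
    moreover have "poly R x = (-1)^(n-1) / fact (2*n-k-1) * a^(n-k) * ((x - 1)^n * (-1)^n) * h_poly n k x a"
      by (simp add: R_def poly_power p2(2))
    ultimately show ?thesis by simp
  qed
  have dL: "degree L < 2 * n"
  proof -
    have "degree L \<le> n + (n - 1)"
      unfolding L_def using p1(1)
      by (intro order_trans[OF degree_mult_le] add_mono order_trans[OF degree_smult_le])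
        (auto simp: degree_pcompose intro: order_trans[OF degree_power_le])
    then show ?thesis using assms(1) by linarith
  qed
  have dR: "degree R < 2 * n"
  proof -
    have "degree R \<le> n + (n - 1)"
      unfolding R_def using p2(1)
      by (intro order_trans[OF degree_mult_le] add_mono order_trans[OF degree_smult_le])
        (auto intro: order_trans[OF degree_power_le])
    then show ?thesis using assms(1) by linarith
  qed
  have "poly (L - R) = poly (smult ((-1)^(n-k-1) / fact (2*n-k-1)) ([:-a, 1:] ^ (2*n-k-1)))"
  proof
    fix x
    have "(-1)^(n-1) = (-1)^(n-k-1) * ((-1)^k :: real)"
      using k by (simp flip: power_add)
    then have "poly (L - R) x = (-1)^(n-k-1) / fact (2*n-k-1) *
        ((1-a)^(n-k) * x^n * h_poly n k (1-x) (1-a) - (-1)^k * a^(n-k) * (1-x)^n * h_poly n k x a)"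
      by (simp add: polyL polyR right_diff_distrib)
    also have "\<dots> = (-1)^(n-k-1) / fact (2*n-k-1) * (x - a)^(2*n-k-1)"
    proof -
      have "2*n-1-k = 2*n-k-1" by simp
      then show ?thesis by (simp only: h_poly_identity[OF assms(1) k])
    qed
    finally show "poly (L - R) x = poly (smult ((-1)^(n-k-1) / fact (2*n-k-1)) ([:-a, 1:] ^ (2*n-k-1))) x"
      by (simp add: poly_power)
  qed
  then have LR: "L - R = smult ((-1)^(n-k-1) / fact (2*n-k-1)) ([:-a, 1:] ^ (2*n-k-1))"
    by (simp only: poly_eq_poly_eq_iff)
  have dvd: "[:0, 1:] ^ n dvd L" "[:-1, 1:] ^ n dvd R"
    unfolding L_def R_def by (rule dvd_triv_left)+
  note repr = glue_reproduces_derivative[OF assms(3) k _ dvd(1) dL dvd(2) dR LR]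
  \<comment> \<open>Membership in \<open>repr(1)\<close> is stated under the premise that some
    \<open>f\<close> lies in the space; the zero function supplies one.\<close>
  have zero: "(\<lambda>x\<in>{0..1}. 0) \<in> sobolev0 n"
    using glue_in_sobolev0[OF assms(3,1), of 0 0] by (simp add: glue_def restrict_def cong: if_cong)
  have G: "G \<in> sobolev0 n" "\<And>f. f \<in> sobolev0 n \<Longrightarrow> nth_deriv k f a = sobolev_inner n f G"
    using repr(1)[OF zero] repr(2) by (auto simp: G_def)
  \<comment> \<open>Both representations are tested on \<open>g\<close> and on \<open>G\<close>,
    which gives the two equations between inner products required by
    \<open>sobolev0_eqI\<close>.\<close>
  have uniq: "g = G" if "g \<in> sobolev0 n" "\<forall>f\<in>sobolev0 n. nth_deriv k f a = sobolev_inner n f g" for g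
    using that G assms(1) by (intro sobolev0_eqI) auto
  have ex1: "\<exists>!g. g \<in> sobolev0 n \<and> (\<forall>f\<in>sobolev0 n. nth_deriv k f a = sobolev_inner n f g)"
    using G uniq by blast
  have gG: "g_repr n k a = G"
    unfolding g_repr_def using G uniq by (intro the_equality) auto
  \<comment> \<open>The second formula includes \<open>x = a\<close>, where \<open>glue\<close>
    takes the value of \<open>L\<close>.\<close>
  have "poly L a = poly R a"
  proof -
    have "poly (L - R) a = 0" unfolding LR using k by (simp add: poly_power)
    then show ?thesis by simp
  qed
  then have "g_repr n k a x = complex_of_real (poly L x)" if "x \<in> {0..a}" for x
    using that assms(3) by (simp add: gG G_def glue_def)
  moreover have "g_repr n k a x = complex_of_real (poly R x)" if "x \<in> {a..1}" for x
    using that assms(3) \<open>poly L a = poly R a\<close> by (cases "x = a") (auto simp: gG G_def glue_def)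
  ultimately show ?thesis
    using ex1 unfolding polyL polyR by blast
qed

end
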